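(* Let $f(t)=t^\top\widetilde Gt+2w^\top t$ for $t\in\mathbb{R}^{nM}$. Suppose that $t^*$ is the unique global minimizer of the problem (SQP2) $$\min_{t\in\mathbb{R}^{nM}} f(t)\quad\text{s.t. } \boldsymbol{e}^\top\bar t_j=1,\ j=1,\ldots,n,\quad t\geqslant 0,\quad \|t\|_0\leqslant n.$$ Then $t^*$ is the unique global minimizer of the problem (RSQP) $$\min_{t\in\mathbb{R}^{nM}} f(t)\quad\text{s.t. } \boldsymbol{e}^\top\bar t_j=1,\ j=1,\ldots,n,\quad t\geqslant 0.$$
   Context: $m,n\geqslant1$ and $M\geqslant 2$ are integers, $H\in\mathbb{C}^{m\times n}$, $r\in\mathbb{C}^m$; $(\cdot)^\dagger$ is the conjugate transpose. $Q=H^\dagger H$, $c=-H^\dagger r$. $\widehat Q=\begin{bmatrix}\mathrm{Re}(Q)&-\mathrm{Im}(Q)\\ \mathrm{Im}(Q)&\mathrm{Re}(Q)\end{bmatrix}\in\mathbb{R}^{2n\times 2n}$, $\hat c=\begin{bmatrix}\mathrm{Re}(c)\\ \mathrm{Im}(c)\end{bmatrix}\in\mathbb{R}^{2n}$. $\theta_k=2(k-1)\pi/M$ for $k=1,\ldots,M$; $\alpha=(\cos\theta_1,\ldots,\cos\theta_M)^\top$, $\beta=(\sin\theta_1,\ldots,\sin\theta_M)^\top\in\mathbb{R}^M$. $A=I\otimes\alpha^\top$, $B=I\otimes\beta^\top\in\mathbb{R}^{n\times nM}$ ($I$ the $n\times n$ identity, $\otimes$ the Kronecker product), $P=\begin{bmatrix}A\\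 B\end{bmatrix}\in\mathbb{R}^{2n\times nM}$, $G=P^\top\widehat QP\in\mathbb{R}^{nM\times nM}$, $w=P^\top\hat c\in\mathbb{R}^{nM}$. $G$ is partitioned into $n\times n$ blocks $S_{jk}\in\mathbb{R}^{M\times M}$; $\widetilde D=\mathrm{Diag}(S_{11},\ldots,S_{nn})$ is the block-diagonal matrix of the diagonal blocks, and $\widetilde G=G-\widetilde D$. A vector $t\in\mathbb{R}^{nM}$ is partitioned as $t=(\bar t_1^\top,\ldots,\bar t_n^\top)^\top$ with blocks $\bar t_j\in\mathbb{R}^M$. $\boldsymbol{e}$ is the all-ones vector, $\|t\|_0$ is the number of nonzero entries of $t$, and $t\geqslant0$ is entrywise. *)

theory Defs
  imports "Jordan_Normal_Form.Schur_Decomposition"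
begin

text \<open>
  All dimensions are explicit natural numbers, and matrices and vectors are those of
  \<^theory>\<open>Jordan_Normal_Form.Matrix\<close>.  Indices start at 0, so the angle, block and entry
  indices below are shifted by one against the usual \<open>1, \<dots>, M\<close> and \<open>1, \<dots>, n\<close>.
\<close>

definition Q_mat :: "complex mat \<Rightarrow> complex mat" where
  "Q_mat H = mat_adjoint H * H"

definition c_vec :: "complex mat \<Rightarrow> complex vec \<Rightarrow> complex vec" where
  "c_vec H r = - (mat_adjoint H *\<^sub>v r)"

definition Q_hat :: "complex mat \<Rightarrow> real mat" where
  "Q_hat H = four_block_mat (map_mat Re (Q_mat H)) (- map_mat Im (Q_mat H))
                            (map_mat Im (Q_mat H)) (map_mat Re (Q_mat H))"

definition c_hat :: "complex mat \<Rightarrow> complex vec \<Rightarrow> real vec" where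
  "c_hat H r = map_vec Re (c_vec H r) @\<^sub>v map_vec Im (c_vec H r)"

definition theta :: "nat \<Rightarrow> nat \<Rightarrow> real" where
  "theta M k = 2 * real k * pi / real M"

definition alpha :: "nat \<Rightarrow> real vec" where
  "alpha M = vec M (\<lambda>k. cos (theta M k))"

definition beta :: "nat \<Rightarrow> real vec" where
  "beta M = vec M (\<lambda>k. sin (theta M k))"

definition kronecker :: "'a :: times mat \<Rightarrow> 'a mat \<Rightarrow> 'a mat" where
  "kronecker X Y = mat (dim_row X * dim_row Y) (dim_col X * dim_col Y)
     (\<lambda>(i, j). X $$ (i div dim_row Y, j div dim_col Y) * Y $$ (i mod dim_row Y, j mod dim_col Y))"

text \<open>\<open>mat_of_rows M [v]\<close> is the row vector \<open>v\<^sup>T\<close>.\<close>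

definition A_mat :: "nat \<Rightarrow> nat \<Rightarrow> real mat" where
  "A_mat n M = kronecker (1\<^sub>m n) (mat_of_rows M [alpha M])"

definition B_mat :: "nat \<Rightarrow> nat \<Rightarrow> real mat" where
  "B_mat n M = kronecker (1\<^sub>m n) (mat_of_rows M [beta M])"

definition P_mat :: "nat \<Rightarrow> nat \<Rightarrow> real mat" where
  "P_mat n M = A_mat n M @\<^sub>r B_mat n M"

definition G_mat :: "nat \<Rightarrow> nat \<Rightarrow> complex mat \<Rightarrow> real mat" where
  "G_mat n M H = transpose_mat (P_mat n M) * Q_hat H * P_mat n M"

definition w_vec :: "nat \<Rightarrow> nat \<Rightarrow> complex mat \<Rightarrow> complex vec \<Rightarrow> real vec" where
  "w_vec n M H r = transpose_mat (P_mat n M) *\<^sub>v c_hat H r"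

definition mat_block :: "nat \<Rightarrow> 'a mat \<Rightarrow> nat \<Rightarrow> nat \<Rightarrow> 'a mat" where
  "mat_block M X j k = mat M M (\<lambda>(a, b). X $$ (j * M + a, k * M + b))"

definition vec_block :: "nat \<Rightarrow> 'a vec \<Rightarrow> nat \<Rightarrow> 'a vec" where
  "vec_block M t j = vec M (\<lambda>a. t $ (j * M + a))"

definition D_tilde :: "nat \<Rightarrow> nat \<Rightarrow> complex mat \<Rightarrow> real mat" where
  "D_tilde n M H = diag_block_mat (map (\<lambda>j. mat_block M (G_mat n M H) j j) [0..<n])"

definition G_tilde :: "nat \<Rightarrow> nat \<Rightarrow> complex mat \<Rightarrow> real mat" where
  "G_tilde n M H = G_mat n M H - D_tilde n M H"

definition objective :: "nat \<Rightarrow> nat \<Rightarrow> complex mat \<Rightarrow> complex vec \<Rightarrow> real vec \<Rightarrow> real" where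
  "objective n M H r t = t \<bullet> (G_tilde n M H *\<^sub>v t) + 2 * (w_vec n M H r \<bullet> t)"

definition ones_vec :: "nat \<Rightarrow> real vec" where
  "ones_vec M = vec M (\<lambda>_. 1)"

definition norm0 :: "'a :: zero vec \<Rightarrow> nat" where
  "norm0 t = card {i. i < dim_vec t \<and> t $ i \<noteq> 0}"

definition RSQP_feasible :: "nat \<Rightarrow> nat \<Rightarrow> real vec set" where
  "RSQP_feasible n M = {t \<in> carrier_vec (n * M).
     (\<forall>j<n. ones_vec M \<bullet> vec_block M t j = 1) \<and> 0\<^sub>v (n * M) \<le> t}"

definition SQP2_feasible :: "nat \<Rightarrow> nat \<Rightarrow> real vec set" where
  "SQP2_feasible n M = {t \<in> carrier_vec (n * M).
     (\<forall>j<n. ones_vec M \<bullet> vec_block M t j = 1) \<and> 0\<^sub>v (n * M) \<le> t \<and> norm0 t \<le> n}"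

definition unique_global_minimizer :: "('a \<Rightarrow> real) \<Rightarrow> 'a set \<Rightarrow> 'a \<Rightarrow> bool" where
  "unique_global_minimizer f S x \<longleftrightarrow>
     is_arg_min f (\<lambda>y. y \<in> S) x \<and> (\<forall>y. is_arg_min f (\<lambda>y. y \<in> S) y \<longrightarrow> y = x)"

end

theory Submission
  imports Defs
begin

text \<open>
  Moving mass between two coordinates of the same block changes the objective affinely, because
  the diagonal blocks of \<open>G_tilde\<close> vanish.  If a point feasible for (RSQP) has more than \<open>n\<close>
  nonzero entries, two of them share a block by the pigeonhole principle, and shifting all their
  mass to the one or to the other writes the point as a proper convex combination of two distinct
  feasible points of smaller support with the corresponding average objective value.  Induction on
  the support size shows that both have value at least the minimum of (SQP2), at least one of them
  strictly.
\<close>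

section \<open>Vanishing diagonal blocks of the quadratic form\<close>

lemma diag_block_mat_carrier:
  assumes "\<forall>A\<in>set As. A \<in> carrier_mat M M"
  shows "diag_block_mat As \<in> carrier_mat (length As * M) (length As * M)"
  using assms by (induction As) (auto simp: Let_def)

lemma diag_block_mat_index_same_block:
  assumes "\<forall>A\<in>set As. A \<in> carrier_mat M M" and "j < length As" and "a < M" and "b < M"
  shows "diag_block_mat As $$ (j * M + a, j * M + b) = As ! j $$ (a, b)"
  using assms(1,2)
proof (induction As arbitrary: j)
  case (Cons A As)
  have A: "A \<in> carrier_mat M M"
    using Cons.prems by simp
  have D: "diag_block_mat As \<in> carrier_mat (length As * M) (length As * M)"
    using Cons.prems by (intro diag_block_mat_carrier) simp
  show ?case
  proof (cases j)
    case 0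
    then show ?thesis
      using A D assms(3,4) by (simp add: Let_def)
  next
    case (Suc i)
    have "i < length As"
      using Suc Cons.prems by simp
    \<comment> \<open>Peeling off the head block shifts both indices by \<open>M\<close>; this bound
      places the shifted indices inside the tail matrix, so the lookup falls into its block.\<close>
    then have "Suc i * M \<le> length As * M"
      by (intro mult_le_mono1) simp
    then have "i * M + a < length As * M" and "i * M + b < length As * M"
      using assms(3,4) by simp_all
    then show ?thesis
      using A D assms(3,4) Suc Cons \<open>i < length As\<close> by (auto simp: Let_def)
  qed
qed simp

lemma P_mat_carrier: "P_mat n M \<in> carrier_mat (2 * n) (n * M)"
  unfolding P_mat_def mult_2
  by (rule carrier_append_rows) (auto simp: A_mat_def B_mat_def kronecker_def)

lemma w_vec_carrier: "w_vec n M H r \<in> carrier_vec (n * M)"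
  using P_mat_carrier[of n M] by (intro carrier_vecI) (simp add: w_vec_def)

lemma D_tilde_carrier: "D_tilde n M H \<in> carrier_mat (n * M) (n * M)"
  unfolding D_tilde_def
  using diag_block_mat_carrier[of "map (\<lambda>j. mat_block M (G_mat n M H) j j) [0..<n]" M]
  by (simp add: mat_block_def)

lemma G_tilde_carrier: "G_tilde n M H \<in> carrier_mat (n * M) (n * M)"
  using D_tilde_carrier[of n M H] by (auto simp: G_tilde_def)

text \<open>Equal quotients by \<open>M\<close> mean that row and column fall into the same diagonal
  block, where \<open>D_tilde\<close> copies \<open>G_mat\<close> and the difference
  cancels.\<close>

lemma G_tilde_index_same_block:
  assumes "p < n * M" and "q < n * M" and "p div M = q div M"
  shows "G_tilde n M H $$ (p, q) = 0"
proof -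
  define j where "j = p div M"
  have "M > 0"
    using assms(1) by (cases M) auto
  moreover have p: "p = j * M + p mod M" and q: "q = j * M + q mod M"
    unfolding j_def using assms(3) by (metis div_mult_mod_eq)+
  moreover have "j < n"
    using assms(1) by (simp add: j_def less_mult_imp_div_less)
  ultimately have "D_tilde n M H $$ (p, q) = G_mat n M H $$ (p, q)"
    using diag_block_mat_index_same_block
      [of "map (\<lambda>j. mat_block M (G_mat n M H) j j) [0..<n]" M j "p mod M" "q mod M"]
    by (simp add: D_tilde_def mat_block_def)
  then show ?thesis
    using assms D_tilde_carrier[of n M H] by (simp add: G_tilde_def)
qed

section \<open>Moving mass within a block: objective and block sums\<close>

lemma objective_add_unit_diff:
  assumes t: "t \<in> carrier_vec (n * M)"
    and a: "a < n * M" and b: "b < n * M" and ab: "a div M = b div M"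
  obtains L where "\<And>s. objective n M H r (t + s \<cdot>\<^sub>v (unit_vec (n * M) a - unit_vec (n * M) b))
      = objective n M H r t + s * L"
proof -
  define N where "N = n * M"
  define G where "G = G_tilde n M H"
  define w where "w = w_vec n M H r"
  define d :: "real vec" where "d = unit_vec N a - unit_vec N b"
  have G: "G \<in> carrier_mat N N"
    unfolding N_def G_def by (rule G_tilde_carrier)
  have w: "w \<in> carrier_vec N"
    unfolding N_def w_def by (rule w_vec_carrier)
  have d: "d \<in> carrier_vec N"
    by (simp add: d_def)
  note t = t[folded N_def] and a = a[folded N_def] and b = b[folded N_def]
  have col: "(G *\<^sub>v d) $ i = G $$ (i, a) - G $$ (i, b)" if "i < N" for i
    using that G a b unfolding d_def
    by (simp add: scalar_prod_minus_distrib[where n = N] scalar_prod_right_unit[where n = N])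
  have "d \<bullet> (G *\<^sub>v d) = (G *\<^sub>v d) $ a - (G *\<^sub>v d) $ b"
    using G a b d unfolding d_def
    by (subst minus_scalar_prod_distrib[where n = N])
       (auto simp: scalar_prod_left_unit[where n = N] intro!: mult_mat_vec_carrier[of _ N N])
  \<comment> \<open>Only the entries of \<open>G\<close> at (a,a), (a,b), (b,a) and (b,b) remain,
    and all four lie in one diagonal block. So the coefficient of \<open>s * s\<close> vanishes and
    the objective is affine in \<open>s\<close>.\<close>
  also have "\<dots> = 0"
    using col a b ab by (simp add: G_def N_def G_tilde_index_same_block)
  finally have dGd: "d \<bullet> (G *\<^sub>v d) = 0" .
  have "objective n M H r (t + s \<cdot>\<^sub>v d)
      = objective n M H r t + s * (t \<bullet> (G *\<^sub>v d) + d \<bullet> (G *\<^sub>v t) + 2 * (w \<bullet> d))" for s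
  proof -
    have Gv: "G *\<^sub>v v \<in> carrier_vec N" if "v \<in> carrier_vec N" for v
      using G that by (rule mult_mat_vec_carrier)
    have sd: "s \<cdot>\<^sub>v d \<in> carrier_vec N"
      using d by simp
    have "G *\<^sub>v (t + s \<cdot>\<^sub>v d) = G *\<^sub>v t + s \<cdot>\<^sub>v (G *\<^sub>v d)"
      using G t d by (simp add: mult_add_distrib_mat_vec[OF G t sd] mult_mat_vec[OF G d])
    then have "(t + s \<cdot>\<^sub>v d) \<bullet> (G *\<^sub>v (t + s \<cdot>\<^sub>v d))
        = t \<bullet> (G *\<^sub>v t) + s * (t \<bullet> (G *\<^sub>v d)) + s * (d \<bullet> (G *\<^sub>v t)) + s * s * (d \<bullet> (G *\<^sub>v d))"
      using t d sd Gv[OF t] Gv[OF d]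
      by (simp add: add_scalar_prod_distrib[where n = N] scalar_prod_add_distrib[where n = N]
          algebra_simps)
    moreover have "w \<bullet> (t + s \<cdot>\<^sub>v d) = w \<bullet> t + s * (w \<bullet> d)"
      using w t d by (simp add: scalar_prod_add_distrib[where n = N])
    ultimately show ?thesis
      unfolding objective_def G_def[symmetric] w_def[symmetric] dGd
      by (simp add: algebra_simps)
  qed
  then show thesis
    using that unfolding d_def N_def by blast
qed

lemma ones_vec_block_add_unit_diff:
  assumes t: "t \<in> carrier_vec (n * M)" and j: "j < n"
    and a: "a < n * M" and b: "b < n * M" and ab: "a div M = b div M"
  shows "ones_vec M \<bullet> vec_block M (t + s \<cdot>\<^sub>v (unit_vec (n * M) a - unit_vec (n * M) b)) j
    = ones_vec M \<bullet> vec_block M t j"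
proof -
  have less: "j * M + k < n * M" if "k < M" for k
  proof -
    have "Suc j * M \<le> n * M"
      using j by (intro mult_le_mono1) simp
    then show ?thesis
      using that by simp
  qed
  \<comment> \<open>The contribution of the unit vector at \<open>p\<close> to the sum of block
    \<open>j\<close>. It depends on \<open>p\<close> only through \<open>p div M\<close>, so those
    of \<open>a\<close> and \<open>b\<close> cancel in every block.\<close>
  have block_sum: "(\<Sum>k<M. if j * M + k = p then 1 else 0) = (if p div M = j then 1 else (0::real))"
    if "p < n * M" for p
  proof -
    have M: "M > 0"
      using that by (cases M) auto
    have "(\<Sum>k<M. if j * M + k = p then 1 else (0::real))
        = (\<Sum>k<M. if k = p mod M then if p div M = j then 1 else 0 else 0)"
    proof (intro sum.cong refl)
      fix k
      assume "k \<in> {..<M}"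
      then have "(j * M + k) div M = j" and "(j * M + k) mod M = k"
        by simp_all
      then have "j * M + k = p \<longleftrightarrow> k = p mod M \<and> p div M = j"
        by (metis div_mult_mod_eq)
      then show "(if j * M + k = p then 1 else (0::real))
          = (if k = p mod M then if p div M = j then 1 else 0 else 0)"
        by simp
    qed
    then show ?thesis
      using M by simp
  qed
  have "ones_vec M \<bullet> vec_block M (t + s \<cdot>\<^sub>v (unit_vec (n * M) a - unit_vec (n * M) b)) j
      = (\<Sum>k<M. t $ (j * M + k)
          + s * ((if j * M + k = a then 1 else 0) - (if j * M + k = b then 1 else 0)))"
    using t a b less
    by (auto simp: scalar_prod_def ones_vec_def vec_block_def lessThan_atLeast0 intro!: sum.cong)
  also have "\<dots> = (\<Sum>k<M. t $ (j * M + k))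
      + s * ((\<Sum>k<M. if j * M + k = a then 1 else 0) - (\<Sum>k<M. if j * M + k = b then 1 else 0))"
    by (simp only: sum.distrib sum_subtractf sum_distrib_left[symmetric])
  also have "\<dots> = ones_vec M \<bullet> vec_block M t j"
    using a b ab
    by (simp only: block_sum) (simp add: scalar_prod_def ones_vec_def vec_block_def lessThan_atLeast0)
  finally show ?thesis .
qed

section \<open>Shrinking the support of a feasible point\<close>

lemma same_block_nonzeros:
  assumes "t \<in> carrier_vec (n * M)" and "norm0 t > n"
  obtains a b where "a < n * M" "b < n * M" "a \<noteq> b" "a div M = b div M" "t $ a \<noteq> 0" "t $ b \<noteq> 0"
proof -
  let ?S = "{i. i < dim_vec t \<and> t $ i \<noteq> 0}"
  \<comment> \<open>The map from an index to its block has at most \<open>n\<close> values, fewer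
    than the nonzero positions, so it cannot be injective on them.\<close>
  have "(\<lambda>i. i div M) ` ?S \<subseteq> {..<n}"
    using assms(1) by (auto simp: less_mult_imp_div_less)
  then have "card ((\<lambda>i. i div M) ` ?S) \<le> n"
    using card_mono[of "{..<n}"] by fastforce
  then have "\<not> inj_on (\<lambda>i. i div M) ?S"
    using assms(2) by (intro pigeonhole) (simp add: norm0_def)
  then show thesis
    using that assms(1) unfolding inj_on_def by auto
qed

lemma RSQP_feasible_iff:
  "t \<in> RSQP_feasible n M \<longleftrightarrow> t \<in> carrier_vec (n * M)
     \<and> (\<forall>j<n. ones_vec M \<bullet> vec_block M t j = 1) \<and> (\<forall>i<n * M. 0 \<le> t $ i)"
  unfolding RSQP_feasible_def less_eq_vec_def mem_Collect_eq
  by (metis carrier_vecD index_zero_vec)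

text \<open>The step \<open>t $ b\<close> is exactly the one that empties position \<open>b\<close>.
  Position \<open>a\<close> was already occupied, so the support loses \<open>b\<close> and gains
  nothing. The last two conclusions serve to tell apart the two opposite shifts of one
  point.\<close>

lemma RSQP_feasible_move_mass:
  assumes t: "t \<in> RSQP_feasible n M"
    and a: "a < n * M" and b: "b < n * M" and "a \<noteq> b" and ab: "a div M = b div M"
    and nz: "t $ a \<noteq> 0" "t $ b \<noteq> 0"
  defines "u \<equiv> t + (t $ b) \<cdot>\<^sub>v (unit_vec (n * M) a - unit_vec (n * M) b)"
  shows "u \<in> RSQP_feasible n M" and "norm0 u < norm0 t" and "u $ b = 0" and "u $ a > 0"
proof -
  have tc: "t \<in> carrier_vec (n * M)" and nonneg: "\<And>i. i < n * M \<Longrightarrow> 0 \<le> t $ i"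
    using t by (simp_all add: RSQP_feasible_iff)
  have u: "u $ i = (if i = a then t $ a + t $ b else if i = b then 0 else t $ i)"
    if "i < n * M" for i
    using that tc a b \<open>a \<noteq> b\<close> by (auto simp: u_def)
  have dim: "dim_vec u = n * M"
    using tc by (simp add: u_def)
  show "u \<in> RSQP_feasible n M"
    unfolding RSQP_feasible_iff
  proof (intro conjI allI impI)
    show "u \<in> carrier_vec (n * M)"
      using dim by (rule carrier_vecI)
    show "ones_vec M \<bullet> vec_block M u j = 1" if "j < n" for j
      using t that ones_vec_block_add_unit_diff[OF tc that a b ab]
      by (simp add: RSQP_feasible_iff u_def)
    show "0 \<le> u $ i" if "i < n * M" for i
      using u[OF that] nonneg[OF that] nonneg[OF a] nonneg[OF b] by simp
  qed
  show "u $ b = 0" and "u $ a > 0"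
    using u a b \<open>a \<noteq> b\<close> nonneg[OF a] nonneg[OF b] nz by auto
  have "{i. i < dim_vec u \<and> u $ i \<noteq> 0} \<subset> {i. i < dim_vec t \<and> t $ i \<noteq> 0}"
  proof (rule psubsetI)
    show "{i. i < dim_vec u \<and> u $ i \<noteq> 0} \<subseteq> {i. i < dim_vec t \<and> t $ i \<noteq> 0}"
    proof safe
      fix i
      assume "i < dim_vec u" and "u $ i \<noteq> 0"
      then show "i < dim_vec t"
        using tc dim by simp
    next
      fix i
      assume "i < dim_vec u" and "u $ i \<noteq> 0" and "t $ i = 0"
      then show False
        using u[of i] dim nz by (cases "i = a"; cases "i = b") simp_all
    qed
    show "{i. i < dim_vec u \<and> u $ i \<noteq> 0} \<noteq> {i. i < dim_vec t \<and> t $ i \<noteq> 0}"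
    proof
      assume "{i. i < dim_vec u \<and> u $ i \<noteq> 0} = {i. i < dim_vec t \<and> t $ i \<noteq> 0}"
      moreover have "b \<in> {i. i < dim_vec t \<and> t $ i \<noteq> 0}"
        using tc b nz(2) by simp
      ultimately show False
        using \<open>u $ b = 0\<close> by blast
    qed
  qed
  then show "norm0 u < norm0 t"
    unfolding norm0_def by (intro psubset_card_mono) auto
qed

text \<open>Excluding \<open>t\<^sub>0\<close> from the claim makes the induction carry strictness:
  a shifted point that happens to be \<open>t\<^sub>0\<close> still satisfies the weak
  inequality.\<close>

lemma RSQP_strict_minimum:
  assumes min: "\<And>s. s \<in> SQP2_feasible n M \<Longrightarrow> s \<noteq> t\<^sub>0 \<Longrightarrow>
      objective n M H r t\<^sub>0 < objective n M H r s"
    and t: "t \<in> RSQP_feasible n M" and "t \<noteq> t\<^sub>0"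
  shows "objective n M H r t\<^sub>0 < objective n M H r t"
  using t \<open>t \<noteq> t\<^sub>0\<close>
proof (induction "norm0 t" arbitrary: t rule: less_induct)
  case less
  have tc: "t \<in> carrier_vec (n * M)" and nonneg: "\<And>i. i < n * M \<Longrightarrow> 0 \<le> t $ i"
    using less.prems by (simp_all add: RSQP_feasible_iff)
  let ?f = "objective n M H r"
  show ?case
  proof (cases "norm0 t \<le> n")
    case True
    then show ?thesis
      using less.prems by (intro min) (simp_all add: RSQP_feasible_def SQP2_feasible_def)
  next
    case False
    then have "norm0 t > n"
      by simp
    then obtain a b where ab: "a < n * M" "b < n * M" "a \<noteq> b" "a div M = b div M"
      and nz: "t $ a \<noteq> 0" "t $ b \<noteq> 0"
      by (rule same_block_nonzeros[OF tc])
    define d :: "real vec" where "d = unit_vec (n * M) a - unit_vec (n * M) b"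
    define u where "u = t + (t $ b) \<cdot>\<^sub>v d"
    define v where "v = t + (t $ a) \<cdot>\<^sub>v (unit_vec (n * M) b - unit_vec (n * M) a)"
    \<comment> \<open>The definition of \<open>v\<close> matches the previous lemma with
      \<open>a\<close> and \<open>b\<close> swapped; this form puts \<open>u\<close> and
      \<open>v\<close> on one line through \<open>t\<close>, on opposite sides, so that a single
      slope \<open>L\<close> governs both.\<close>
    have v: "v = t + (- t $ a) \<cdot>\<^sub>v d"
      using tc by (intro eq_vecI) (auto simp: v_def d_def algebra_simps)
    obtain L where L: "\<And>s. ?f (t + s \<cdot>\<^sub>v d) = ?f t + s * L"
      using objective_add_unit_diff[OF tc ab(1,2,4)] unfolding d_def by blast
    note u_props = RSQP_feasible_move_mass[OF less.prems(1) ab nz, folded d_def, folded u_def]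
    note v_props = RSQP_feasible_move_mass
      [OF less.prems(1) ab(2,1) ab(3,4)[symmetric] nz(2,1), folded v_def]
    have pos: "t $ a > 0" "t $ b > 0"
      using nonneg[OF ab(1)] nonneg[OF ab(2)] nz by auto
    have less_u: "?f t\<^sub>0 < ?f u" if "u \<noteq> t\<^sub>0"
      using less.hyps[OF u_props(2,1) that] .
    have less_v: "?f t\<^sub>0 < ?f v" if "v \<noteq> t\<^sub>0"
      using less.hyps[OF v_props(2,1) that] .
    have le: "?f t\<^sub>0 \<le> ?f u" "?f t\<^sub>0 \<le> ?f v"
      using less_u less_v by (cases "u = t\<^sub>0"; cases "v = t\<^sub>0"; simp)+
    \<comment> \<open>At position \<open>b\<close>, \<open>u\<close> is zero and \<open>v\<close> is
      positive. Hence at most one of them is \<open>t\<^sub>0\<close>, and the other has a strictly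
      larger value.\<close>
    have "u \<noteq> v"
      using u_props(3) v_props(4) by auto
    then have strict: "?f t\<^sub>0 < ?f u \<or> ?f t\<^sub>0 < ?f v"
      using less_u less_v by (cases "u = t\<^sub>0") simp_all
    have fu: "?f u = ?f t + t $ b * L" and fv: "?f v = ?f t - t $ a * L"
      using L unfolding u_def v by simp_all
    \<comment> \<open>If \<open>L\<close> is nonzero, the shift in the descending direction lies
      strictly below \<open>t\<close>, so the weak bound on it suffices. If \<open>L = 0\<close>,
      all three values agree and the strict bound at one of the shifts is used.\<close>
    consider "L = 0" | "L > 0" | "L < 0"
      by linarith
    then show ?thesis
    proof cases
      case 1
      then show ?thesis
        using strict fu fv by simp
    next
      case 2
      then show ?thesis
        using le(2) fv mult_pos_pos[OF pos(1) 2] by linarith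
    next
      case 3
      then show ?thesis
        using le(1) fu mult_pos_neg[OF pos(2) 3] by linarith
    qed
  qed
qed

theorem theorem3p5:
  fixes m n M :: nat and H :: "complex mat" and r :: "complex vec" and t_star :: "real vec"
  assumes "m \<ge> 1" and "n \<ge> 1" and "M \<ge> 2"
    and "H \<in> carrier_mat m n" and "r \<in> carrier_vec m"
    and "unique_global_minimizer (objective n M H r) (SQP2_feasible n M) t_star"
  shows "unique_global_minimizer (objective n M H r) (RSQP_feasible n M) t_star"
proof -
  let ?f = "objective n M H r"
  have feas: "t_star \<in> SQP2_feasible n M"
    and le: "\<And>s. s \<in> SQP2_feasible n M \<Longrightarrow> ?f t_star \<le> ?f s"
    and uniq: "\<And>s. is_arg_min ?f (\<lambda>y. y \<in> SQP2_feasible n M) s \<Longrightarrow> s = t_star"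
    using assms(6) by (auto simp: unique_global_minimizer_def is_arg_min_linorder)
  \<comment> \<open>A second sparse feasible point with the minimal value would itself be a
    minimizer, against uniqueness.\<close>
  have "?f t_star < ?f s" if "s \<in> SQP2_feasible n M" "s \<noteq> t_star" for s
    using uniq[of s] that le by (fastforce simp: is_arg_min_linorder)
  then have less: "?f t_star < ?f t" if "t \<in> RSQP_feasible n M" "t \<noteq> t_star" for t
    using RSQP_strict_minimum[of n M t_star H r] that by blast
  have "t_star \<in> RSQP_feasible n M"
    using feas by (auto simp: RSQP_feasible_def SQP2_feasible_def)
  \<comment> \<open>The strict inequality gives both halves: nothing feasible beats
    \<open>t_star\<close>, and any other feasible point is beaten by it.\<close>
  then show ?thesis
    using less unfolding unique_global_minimizer_def is_arg_min_def
    by (metis less_asym)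
qed

end
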